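(* Let $\psi(x)=x^2$ for all $x\in\mathbb{R}$, let $s>1$, let $\omega(t)=|t|^{1/s}$ and let $\sigma(t):=\omega(t^{1/2})$, $t\ge 0$. Then the family $\{C_{\psi_m}:\mathcal{S}_{\omega}(\mathbb{R})\to \mathcal{S}_{\sigma}(\mathbb{R}):m\in\mathbb{N}\}$ is not $m$-topologizable.
   Context: For a continuous increasing function $\omega:[0,\infty)\to[0,\infty)$ which is a weight function in the sense of Braun–Meise–Taylor (as are the powers $t^{1/r}$, $r>1$), put $\varphi_\omega(t):=\omega(e^t)$ and let $\varphi_\omega^*(s):=\sup\{st-\varphi_\omega(t): t\ge 0\}$, $s\ge 0$, be its Young conjugate. The space $\mathcal{S}_\omega(\mathbb{R})$ consists of all $f\in C^\infty(\mathbb{R})$ such that for every $\lambda>0$ $$p_{\omega,\lambda}(f):=\sup_{x\in\mathbb{R}}\sup_{n,q\in\mathbb{N}_0}(1+|x|)^q|f^{(n)}(x)|\exp\left(-\lambda\varphi_\omega^*\left(\tfrac{n+q}{\lambda}\right)\right)<\infty,$$ with the Fréchet topology given by the system of seminorms $\{p_{\omega,\lambda}:\lambda>0\}$. For a polynomial $\psi$, $\psi_m=\psi\circ\cdots\circ\psi$ ($m$ times), and $C_{\psi_m}f:=f\circ\psi_m$. (It is known that for $\omega$ sub-additive and every polynomial $\psi$ of degree greater than one, $C_\psi$ maps $\mathcal{S}_\omega(\mathbb{R})$ continuously into $\mathcal{S}_{\omega(\bullet^{1/2})}(\mathbb{R})$.) For locally convex Hausdorff spaces $E,F$ with topologies determined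 by systems of continuous seminorms $cs(E)$, $cs(F)$ (here the systems $p_{\cdot,\lambda}$, $\lambda>0$), a family of continuous linear operators $\{T_m:E\to F: m\in\mathbb{N}\}$ is $m$-topologizable if for every $p\in cs(F)$ there are $q\in cs(E)$ and $C\ge 1$ such that $p(T_k x)\le C^k\,q(x)$ for all $k\in\mathbb{N}$ and all $x\in E$. *)

theory Defs
  imports "HOL-Analysis.Analysis"
begin

text \<open>The library iterates \<^const>\<open>deriv\<close> only for functions from a field to itself,
  so derivatives of functions of a real variable with complex values are iterated here.\<close>

definition nth_deriv :: "nat \<Rightarrow> (real \<Rightarrow> complex) \<Rightarrow> real \<Rightarrow> complex" where
  "nth_deriv n f = ((\<lambda>g x. vector_derivative g (at x)) ^^ n) f"

definition smooth :: "(real \<Rightarrow> complex) \<Rightarrow> bool" where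
  "smooth f \<longleftrightarrow> (\<forall>n x. nth_deriv n f differentiable (at x))"

definition phi :: "(real \<Rightarrow> real) \<Rightarrow> real \<Rightarrow> real" where
  "phi \<omega> t = \<omega> (exp t)"

text \<open>A real supremum suffices: a Braun--Meise--Taylor weight function satisfies
  \<open>log t = o(\<omega> t)\<close> as \<open>t \<rightarrow> \<infinity>\<close>, so the set below is bounded above.\<close>

definition young_conj :: "(real \<Rightarrow> real) \<Rightarrow> real \<Rightarrow> real" where
  "young_conj \<phi> s = (SUP t\<in>{0..}. s * t - \<phi> t)"

text \<open>The seminorms take values in \<^typ>\<open>ennreal\<close>, so that an infinite supremum really is \<open>\<infinity>\<close>.\<close>

definition seminorm_S :: "(real \<Rightarrow> real) \<Rightarrow> real \<Rightarrow> (real \<Rightarrow> complex) \<Rightarrow> ennreal" where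
  "seminorm_S \<omega> lam f =
     (SUP x. SUP n. SUP q.
        ennreal ((1 + \<bar>x\<bar>) ^ q * norm (nth_deriv n f x)
                 * exp (- lam * young_conj (phi \<omega>) (real (n + q) / lam))))"

definition space_S :: "(real \<Rightarrow> real) \<Rightarrow> (real \<Rightarrow> complex) set" where
  "space_S \<omega> = {f. smooth f \<and> (\<forall>lam>0. seminorm_S \<omega> lam f < \<infinity>)}"

definition seminorms_S :: "(real \<Rightarrow> real) \<Rightarrow> ((real \<Rightarrow> complex) \<Rightarrow> ennreal) set" where
  "seminorms_S \<omega> = {seminorm_S \<omega> lam | lam. lam > 0}"

definition seminorm_topology ::
  "(real \<Rightarrow> complex) set \<Rightarrow> ((real \<Rightarrow> complex) \<Rightarrow> ennreal) set \<Rightarrow> (real \<Rightarrow> complex) topology" where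
  "seminorm_topology E P =
     topology_generated_by
       {{g \<in> E. p (\<lambda>x. g x - f x) < ennreal \<epsilon>} | p f \<epsilon>. p \<in> P \<and> f \<in> E \<and> \<epsilon> > 0}"

definition topology_S :: "(real \<Rightarrow> real) \<Rightarrow> (real \<Rightarrow> complex) topology" where
  "topology_S \<omega> = seminorm_topology (space_S \<omega>) (seminorms_S \<omega>)"

definition linear_map_on ::
  "(real \<Rightarrow> complex) set \<Rightarrow> ((real \<Rightarrow> complex) \<Rightarrow> (real \<Rightarrow> complex)) \<Rightarrow> bool" where
  "linear_map_on E T \<longleftrightarrow>
     (\<forall>f\<in>E. \<forall>g\<in>E. \<forall>a b. T (\<lambda>x. a * f x + b * g x) = (\<lambda>x. a * T f x + b * T g x))"

text \<open>\<^const>\<open>continuous_map\<close> includes that \<open>T\<close> maps \<open>S\<^sub>\<omega>\<close> into \<open>S\<^sub>\<sigma>\<close>.\<close>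

definition continuous_operator_S ::
  "(real \<Rightarrow> real) \<Rightarrow> (real \<Rightarrow> real) \<Rightarrow> ((real \<Rightarrow> complex) \<Rightarrow> (real \<Rightarrow> complex)) \<Rightarrow> bool" where
  "continuous_operator_S \<omega> \<sigma> T \<longleftrightarrow>
     linear_map_on (space_S \<omega>) T \<and> continuous_map (topology_S \<omega>) (topology_S \<sigma>) T"

text \<open>The index set is \<open>{1, 2, \<dots>}\<close>; \<open>P\<close> and \<open>Q\<close> are the systems of seminorms on the domain
  \<open>E\<close> and on the codomain. That the \<open>T k\<close> are continuous linear operators between these spaces
  is not part of the predicate, so its negation concerns the estimate alone.\<close>

definition m_topologizable ::
  "'a set \<Rightarrow> ('a \<Rightarrow> ennreal) set \<Rightarrow> ('b \<Rightarrow> ennreal) set \<Rightarrow> (nat \<Rightarrow> 'a \<Rightarrow> 'b) \<Rightarrow> bool" where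
  "m_topologizable E P Q T \<longleftrightarrow>
     (\<forall>p\<in>Q. \<exists>q\<in>P. \<exists>C::real. C \<ge> 1 \<and> (\<forall>k\<ge>1. \<forall>x\<in>E. p (T k x) \<le> ennreal (C ^ k) * q x))"

definition comp_op :: "(real \<Rightarrow> real) \<Rightarrow> (real \<Rightarrow> complex) \<Rightarrow> (real \<Rightarrow> complex)" where
  "comp_op \<psi> f = f \<circ> \<psi>"

end

theory Submission
  imports Defs
begin

text \<open>Write \<open>M = 2 ^ m\<close>, so that \<open>\<psi>\<^sub>m x = x ^ M\<close>. By induction
  \<open>(f \<circ> \<psi>\<^sub>m)\<^sup>(\<^sup>n\<^sup>) x = (\<Sum>k\<le>n. a\<^sub>n\<^sub>,\<^sub>k * x ^ (M * k - n) * f\<^sup>(\<^sup>k\<^sup>) (x ^ M))\<close> with natural numbers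
  \<open>a\<^sub>n\<^sub>,\<^sub>k \<le> (2 * M) ^ n * n! / k!\<close>, and \<open>a\<^sub>n\<^sub>,\<^sub>k = 0\<close> unless \<open>k \<le> n \<le> M * k\<close>. Up to geometric factors
  the weights in the seminorms of \<open>S\<^sub>\<omega>\<close> and \<open>S\<^sub>\<sigma>\<close> are \<open>1 / N! powr s\<close> and \<open>1 / N! powr (2 * s)\<close>;
  controlling the \<open>k\<close>-th summand takes weight index \<open>2 * k + q\<close> on the side of \<open>S\<^sub>\<omega>\<close>, and
  \<open>(2 * k)!\<close> is comparable to \<open>k!\<close> squared. Hence each operator is continuous.

  On the other hand \<open>a\<^sub>n\<^sub>,\<^sub>n = M ^ n = (2 ^ n) ^ m\<close>. If \<open>f\<close> is a Gaussian centred so far to the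
  right that its first \<open>n\<close> derivatives are positive at \<open>1\<close>, then the \<open>n\<close>-th derivative of
  \<open>f \<circ> \<psi>\<^sub>m\<close> at \<open>1\<close> is at least a constant times \<open>(2 ^ n) ^ m\<close>, which outgrows \<open>C ^ m\<close> once
  \<open>2 ^ n > C\<close>.\<close>

section \<open>Iterated derivatives\<close>

lemma nth_deriv_0 [simp]: "nth_deriv 0 f = f"
  by (simp add: nth_deriv_def)

lemma nth_deriv_Suc: "nth_deriv (Suc n) f x = vector_derivative (nth_deriv n f) (at x)"
  by (simp add: nth_deriv_def)

lemma smooth_has_vector_derivative:
  assumes "smooth f"
  shows "(nth_deriv n f has_vector_derivative nth_deriv (Suc n) f x) (at x)"
  using assms by (simp add: smooth_def nth_deriv_Suc vector_derivative_works)

text \<open>Once a sequence \<open>G\<close> of successive derivatives is guessed, no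
  \<open>vector_derivative\<close> has to be computed; every closed form below arises this
  way.\<close>

lemma nth_deriv_eqI:
  assumes "\<And>x. G 0 x = f x"
    and "\<And>n x. (G n has_vector_derivative G (Suc n) x) (at x)"
  shows "nth_deriv n f = G n"
proof (induction n)
  case 0
  then show ?case using assms(1) by auto
next
  case (Suc n)
  then show ?case
    by (auto simp: nth_deriv_Suc intro!: vector_derivative_at assms(2))
qed

lemma smoothI:
  assumes "\<And>x. G 0 x = f x"
    and "\<And>n x. (G n has_vector_derivative G (Suc n) x) (at x)"
  shows "smooth f"
  unfolding smooth_def nth_deriv_eqI[of G, OF assms]
  using assms(2) differentiableI_vector by blast

lemma nth_deriv_add:
  assumes "smooth f" "smooth g"
  shows "nth_deriv n (\<lambda>x. f x + g x) = (\<lambda>x. nth_deriv n f x + nth_deriv n g x)"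
  using assms
  by (auto intro!: nth_deriv_eqI[where G = "\<lambda>n x. nth_deriv n f x + nth_deriv n g x"]
      has_vector_derivative_add smooth_has_vector_derivative)

lemma smooth_diff:
  assumes "smooth f" "smooth g"
  shows "smooth (\<lambda>x. f x - g x)"
  using assms
  by (auto intro!: smoothI[where G = "\<lambda>n x. nth_deriv n f x - nth_deriv n g x"]
      has_vector_derivative_diff smooth_has_vector_derivative)

lemma nth_deriv_zero: "nth_deriv n (\<lambda>x. 0) = (\<lambda>x. 0)"
  by (rule nth_deriv_eqI[where G = "\<lambda>n x. 0"]) auto

section \<open>Derivatives of compositions with a power\<close>

text \<open>The Faa di Bruno coefficients for the inner function \<open>x ^ M\<close>:
  \<open>n! / k!\<close> times the coefficient of \<open>t ^ n\<close> in
  \<open>((1 + t) ^ M - 1) ^ k\<close>. In the recursion \<open>M\<close> comes from the chain rule,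
  \<open>M * k - n\<close> from differentiating the monomial \<open>x ^ (M * k - n)\<close>.\<close>

fun pow_coeff :: "nat \<Rightarrow> nat \<Rightarrow> nat \<Rightarrow> nat" where
  "pow_coeff M 0 k = (if k = 0 then 1 else 0)"
| "pow_coeff M (Suc n) k =
     (if k = 0 then 0 else M * pow_coeff M n (k - 1)) + (M * k - n) * pow_coeff M n k"

lemma pow_coeff_eq_0: "n < k \<Longrightarrow> pow_coeff M n k = 0"
  by (induction n arbitrary: k) auto

text \<open>For fixed \<open>k\<close> the factor \<open>M * k - n\<close> is zero at
  \<open>n = M * k\<close>, and the coefficients for \<open>k - 1\<close> have vanished
  \<open>M\<close> steps before. So no exponent \<open>M * k - n\<close> is truncated under a
  nonzero coefficient.\<close>

lemma pow_coeff_eq_0': "M * k < n \<Longrightarrow> pow_coeff M n k = 0"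
proof (induction n arbitrary: k)
  case (Suc n)
  have "M * (k - 1) < n \<or> M = 0" if "k \<noteq> 0"
    using Suc.prems that by (cases k; cases M) auto
  moreover have "M * k - n = 0 \<or> M * k < n" using Suc.prems by auto
  ultimately show ?case using Suc.IH by auto
qed auto

lemma pow_coeff_self: "pow_coeff M n n = M ^ n"
  by (induction n) (auto simp: pow_coeff_eq_0)

text \<open>Both terms of the recursion are at most \<open>M * k * (2 * M) ^ n * n!\<close>; their
  number gives the \<open>2\<close>, and \<open>k <= n + 1\<close> is absorbed into the
  factorial.\<close>

lemma pow_coeff_le: "pow_coeff M n k * fact k \<le> (2 * M) ^ n * fact n"
proof (induction n arbitrary: k)
  case (Suc n)
  show ?case
  proof (cases "k = 0 \<or> k > Suc n")
    case False
    then obtain j where k: "k = Suc j" and j: "j \<le> n" by (cases k) auto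
    have "pow_coeff M (Suc n) k * fact k =
        M * k * (pow_coeff M n j * fact j) + (M * k - n) * (pow_coeff M n k * fact k)"
      by (simp add: k add_mult_distrib add_mult_distrib2 mult_ac)
    also have "\<dots> \<le> M * k * ((2 * M) ^ n * fact n) + M * k * ((2 * M) ^ n * fact n)"
      by (intro add_mono mult_mono Suc.IH) auto
    also have "\<dots> = (2 * M) ^ Suc n * (k * fact n)" by simp
    also have "\<dots> \<le> (2 * M) ^ Suc n * (Suc n * fact n)"
      using j k by (intro mult_left_mono mult_right_mono) auto
    finally show ?thesis by (simp add: algebra_simps)
  next
    case True
    then show ?thesis using pow_coeff_eq_0[of "Suc n" k M] by (cases "k = 0") auto
  qed
qed auto

definition pow_deriv :: "nat \<Rightarrow> (real \<Rightarrow> complex) \<Rightarrow> nat \<Rightarrow> real \<Rightarrow> complex" where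
  "pow_deriv M f n x =
     (\<Sum>k\<le>n. of_real (real (pow_coeff M n k) * x ^ (M * k - n)) * nth_deriv k f (x ^ M))"

lemma pow_deriv_has_vector_derivative:
  assumes f: "smooth f" and M: "M \<ge> 1"
  shows "(pow_deriv M f n has_vector_derivative pow_deriv M f (Suc n) x) (at x)"
proof -
  define e where "e k = M * k - n" for k
  define a where "a k = real (pow_coeff M n k)" for k
  define D where "D k = nth_deriv k f (x ^ M)" for k
  \<comment> \<open>\<open>U k\<close> comes from the chain rule and moves to the derivative of
    order \<open>k + 1\<close>; \<open>V k\<close> comes from the monomial and stays at order
    \<open>k\<close>.\<close>
  define U where "U k = of_real (a k * (real M * x ^ (M * Suc k - Suc n))) * D (Suc k)" for k
  define V where "V k = of_real (a k * (real (e k) * x ^ (e k - 1))) * D k" for k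
  have comp: "((\<lambda>x. nth_deriv k f (x ^ M)) has_vector_derivative
      of_real (real M * x ^ (M - 1)) * D (Suc k)) (at x)" for k
  proof -
    have "((\<lambda>x. x ^ M) has_real_derivative real M * x ^ (M - 1)) (at x)"
      by (auto intro!: derivative_eq_intros)
    hence "((\<lambda>x. x ^ M) has_vector_derivative real M * x ^ (M - 1)) (at x)"
      by (simp add: has_real_derivative_iff_has_vector_derivative)
    from vector_diff_chain_at[OF this smooth_has_vector_derivative[OF f, of k "x ^ M"]]
    show ?thesis by (simp add: o_def D_def scaleR_conv_of_real)
  qed
  have mono: "((\<lambda>x. of_real (a k * x ^ e k) :: complex) has_vector_derivative
      of_real (a k * (real (e k) * x ^ (e k - 1)))) (at x)" for k
    by (intro has_vector_derivative_of_real)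
      (auto intro!: derivative_eq_intros simp flip: has_real_derivative_iff_has_vector_derivative)
  have "((\<lambda>x. of_real (a k * x ^ e k) * nth_deriv k f (x ^ M)) has_vector_derivative U k + V k) (at x)"
    for k
  proof -
    \<comment> \<open>The exponent identity needs \<open>n <= M * k\<close>; otherwise subtraction
      truncates, but then the coefficient is zero.\<close>
    have "a k = 0 \<or> (M - 1) + e k = M * Suc k - Suc n"
      using pow_coeff_eq_0'[of M k n] M by (auto simp: a_def e_def not_less)
    hence "a k = 0 \<or> x ^ (M - 1) * x ^ e k = x ^ (M * Suc k - Suc n)"
      by (metis power_add)
    hence "a k * x ^ e k * (real M * x ^ (M - 1)) = a k * (real M * x ^ (M * Suc k - Suc n))"
      by (auto simp: mult_ac)
    hence "of_real (a k * x ^ e k) * (of_real (real M * x ^ (M - 1)) * D (Suc k)) = U k"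
      unfolding U_def by (simp only: mult.assoc[symmetric] flip: of_real_mult)
    thus ?thesis
      using has_vector_derivative_mult[OF mono[of k] comp[of k]]
      by (simp add: V_def D_def)
  qed
  hence "((\<lambda>x. \<Sum>k\<le>n. of_real (a k * x ^ e k) * nth_deriv k f (x ^ M))
      has_vector_derivative (\<Sum>k\<le>n. U k + V k)) (at x)"
    by (intro has_vector_derivative_sum) auto
  moreover have "(\<Sum>k\<le>n. U k + V k) = pow_deriv M f (Suc n) x"
  proof -
    have "pow_deriv M f (Suc n) x =
       (\<Sum>k\<le>Suc n. (if k = 0 then 0 else U (k - 1)) + V k)"
      unfolding pow_deriv_def
    proof (intro sum.cong refl)
      fix k
      have e: "M * k - Suc n = e k - 1" by (simp add: e_def)
      have co: "real (pow_coeff M (Suc n) k) = (if k = 0 then 0 else real M * a (k - 1)) + real (e k) * a k"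
        by (simp add: a_def e_def)
      have U: "U (k - 1) = of_real (real M * a (k - 1) * x ^ (e k - 1)) * D k" if "k \<noteq> 0"
        using that by (simp add: U_def e_def)
      show "of_real (real (pow_coeff M (Suc n) k) * x ^ (M * k - Suc n)) * nth_deriv k f (x ^ M) =
          (if k = 0 then 0 else U (k - 1)) + V k"
        unfolding e co using U by (cases "k = 0") (simp_all add: V_def D_def ring_distribs)
    qed
    also have "\<dots> = (\<Sum>k\<le>Suc n. if k = 0 then 0 else U (k - 1)) + (\<Sum>k\<le>Suc n. V k)"
      by (rule sum.distrib)
    also have "(\<Sum>k\<le>Suc n. if k = 0 then 0 else U (k - 1)) = (\<Sum>k\<le>n. U k)"
      by (subst sum.atMost_Suc_shift) simp
    also have "(\<Sum>k\<le>Suc n. V k) = (\<Sum>k\<le>n. V k)"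
      by (simp add: V_def a_def pow_coeff_eq_0)
    finally show ?thesis by (simp add: sum.distrib)
  qed
  ultimately show ?thesis by (simp add: pow_deriv_def[abs_def] a_def e_def)
qed

lemma
  assumes "smooth f" "M \<ge> 1"
  shows smooth_comp_power: "smooth (\<lambda>x. f (x ^ M))"
    and nth_deriv_comp_power: "nth_deriv n (\<lambda>x. f (x ^ M)) = pow_deriv M f n"
  by (rule smoothI[where G = "pow_deriv M f"] nth_deriv_eqI[where G = "pow_deriv M f"],
      simp add: pow_deriv_def, rule pow_deriv_has_vector_derivative[OF assms])+

section \<open>The weights\<close>

text \<open>The exponential factor of the seminorms for \<open>t powr (1 / c)\<close>. A free
  \<open>c\<close> serves both spaces: \<open>s\<close> for the domain, \<open>2 * s\<close> for the
  codomain.\<close>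

definition weight :: "real \<Rightarrow> real \<Rightarrow> nat \<Rightarrow> real" where
  "weight c lam N = exp (- lam * young_conj (\<lambda>t. exp (t / c)) (real N / lam))"

lemma weight_pos: "weight c lam N > 0"
  by (simp add: weight_def)

lemma power_div_fact_le_exp:
  fixes y :: real
  assumes "y \<ge> 0"
  shows "y ^ N / fact N \<le> exp y"
proof -
  have "(\<Sum>n\<in>{N}. inverse (fact n) *\<^sub>R y ^ n) \<le> (\<Sum>n. inverse (fact n) *\<^sub>R y ^ n)"
    using assms by (intro sum_le_suminf summable_exp_generic) auto
  thus ?thesis by (simp add: exp_def field_simps)
qed

text \<open>Take logarithms in \<open>y ^ N / N! <= exp y\<close> at
  \<open>y = lam / c * exp (t / c)\<close> and multiply by \<open>c\<close>. The bound is free of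
  \<open>t\<close>, so it also gives the boundedness that a real supremum requires.\<close>

lemma young_conj_arg_le:
  assumes "c > 0" "lam > 0"
  shows "real N * t - lam * exp (t / c) \<le> c * ln (fact N) - real N * (c * ln (lam / c))"
proof -
  have "(lam / c * exp (t / c)) ^ N / fact N \<le> exp (lam / c * exp (t / c))"
    by (rule power_div_fact_le_exp) (use assms in auto)
  hence "ln ((lam / c * exp (t / c)) ^ N / fact N) \<le> lam / c * exp (t / c)"
    using assms by (subst (asm) ln_le_cancel_iff[symmetric]) auto
  moreover have "ln ((lam / c * exp (t / c)) ^ N / fact N) = N * (ln (lam / c) + t / c) - ln (fact N)"
    using assms by (simp add: ln_div ln_mult ln_realpow)
  ultimately have "c * (N * (ln (lam / c) + t / c) - ln (fact N)) \<le> c * (lam / c * exp (t / c))"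
    using assms by (intro mult_left_mono) auto
  thus ?thesis using assms by (simp add: algebra_simps)
qed

lemma young_conj_arg_le':
  assumes "c > 0" "lam > 0"
  shows "real N / lam * t - exp (t / c) \<le> (c * ln (fact N) - real N * (c * ln (lam / c))) / lam"
proof -
  have "real N / lam * t - exp (t / c) = (real N * t - lam * exp (t / c)) / lam"
    using assms by (simp add: diff_divide_distrib)
  also have "\<dots> \<le> (c * ln (fact N) - real N * (c * ln (lam / c))) / lam"
    using assms by (intro divide_right_mono young_conj_arg_le) auto
  finally show ?thesis .
qed

text \<open>A bound on the supremum from above is one on the weight from below. Its base
  \<open>(lam / c) powr c\<close> becomes arbitrarily large with \<open>lam\<close>.\<close>

lemma weight_ge:
  assumes "c > 0" "lam > 0"
  shows "((lam / c) powr c) ^ N / fact N powr c \<le> weight c lam N"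
proof -
  have "young_conj (\<lambda>t. exp (t / c)) (real N / lam) \<le> (c * ln (fact N) - real N * (c * ln (lam / c))) / lam"
    unfolding young_conj_def by (intro cSUP_least young_conj_arg_le' assms) auto
  hence "real N * (c * ln (lam / c)) - c * ln (fact N) \<le> - lam * young_conj (\<lambda>t. exp (t / c)) (real N / lam)"
    using assms by (simp add: field_simps)
  moreover have "((lam / c) powr c) ^ N / fact N powr c = exp (real N * (c * ln (lam / c)) - c * ln (fact N))"
    using assms by (simp add: powr_def exp_diff exp_of_nat_mult)
  ultimately show ?thesis by (simp add: weight_def)
qed

text \<open>Evaluating the supremum at \<open>t = c ln N\<close> instead of at the maximiser loses only a
  geometric factor.\<close>

lemma weight_le:
  assumes "c > 0" "lam > 0"
  shows "weight c lam N \<le> exp lam * exp lam ^ N / fact N powr c"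
proof -
  \<comment> \<open>\<open>max N 1\<close> covers \<open>N = 0\<close> and gives
    \<open>t >= 0\<close>, as the supremum ranges over \<open>{0..}\<close> only. Then
    \<open>exp (t / c)\<close> is at most \<open>N + 1\<close> and costs a geometric factor.\<close>
  define t where "t = c * ln (real (max N 1))"
  have t: "t \<ge> 0" using assms by (simp add: t_def)
  have "bdd_above ((\<lambda>t. real N / lam * t - exp (t / c)) ` {0..})"
    using young_conj_arg_le'[OF assms] by (intro bdd_aboveI2) auto
  hence "real N / lam * t - exp (t / c) \<le> young_conj (\<lambda>t. exp (t / c)) (real N / lam)"
    unfolding young_conj_def using t by (intro cSUP_upper) auto
  hence "- lam * young_conj (\<lambda>t. exp (t / c)) (real N / lam) \<le> lam * exp (t / c) - real N * t"
    using assms by (simp add: field_simps)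
  hence "weight c lam N \<le> exp (lam * exp (t / c)) / exp (real N * t)"
    unfolding weight_def by (simp flip: exp_diff)
  also have "exp (t / c) = real (max N 1)"
    using assms by (simp add: t_def)
  also have "exp (lam * real (max N 1)) / exp (real N * t) \<le> exp lam * exp lam ^ N / fact N powr c"
  proof (rule frac_le)
    show "exp (lam * real (max N 1)) \<le> exp lam * exp lam ^ N"
      using assms by (auto simp: max_def algebra_simps simp flip: exp_add exp_of_nat_mult)
    have "fact N powr c \<le> (real (max N 1) ^ N) powr c"
    proof (rule powr_mono2)
      have "(fact N :: real) \<le> real N ^ N" using fact_le_power[of N, where 'a = real] by simp
      also have "\<dots> \<le> real (max N 1) ^ N" by (intro power_mono) auto
      finally show "(fact N :: real) \<le> real (max N 1) ^ N" .
    qed (use assms in auto)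
    also have "\<dots> = exp (real N * t)"
      by (simp add: t_def powr_def ln_realpow algebra_simps)
    finally show "fact N powr c \<le> exp (real N * t)" .
  qed auto
  finally show ?thesis .
qed

section \<open>The seminorms\<close>

lemma seminorm_S_eq:
  assumes "phi w = (\<lambda>t. exp (t / c))"
  shows "seminorm_S w lam f =
     (SUP x. SUP n. SUP q. ennreal ((1 + \<bar>x\<bar>) ^ q * norm (nth_deriv n f x) * weight c lam (n + q)))"
  by (simp add: seminorm_S_def assms weight_def)

lemma seminorm_S_le_iff:
  assumes "phi w = (\<lambda>t. exp (t / c))"
  shows "seminorm_S w lam f \<le> B \<longleftrightarrow>
     (\<forall>x n q. ennreal ((1 + \<bar>x\<bar>) ^ q * norm (nth_deriv n f x) * weight c lam (n + q)) \<le> B)"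
  by (simp add: seminorm_S_eq[OF assms] SUP_le_iff)

lemma le_seminorm_S:
  assumes "phi w = (\<lambda>t. exp (t / c))"
  shows "ennreal ((1 + \<bar>x\<bar>) ^ q * norm (nth_deriv n f x) * weight c lam (n + q)) \<le> seminorm_S w lam f"
  using seminorm_S_le_iff[OF assms, of lam f "seminorm_S w lam f"] by blast

lemma seminorm_S_zero: "seminorm_S w lam (\<lambda>x. 0) = 0"
  by (simp add: seminorm_S_def nth_deriv_zero)

lemma seminorm_S_add:
  assumes w: "phi w = (\<lambda>t. exp (t / c))" and fg: "smooth f" "smooth g"
  shows "seminorm_S w lam (\<lambda>x. f x + g x) \<le> seminorm_S w lam f + seminorm_S w lam g"
proof (subst seminorm_S_le_iff[OF w], intro allI)
  fix x n q
  let ?W = "weight c lam (n + q)"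
  have "(1 + \<bar>x\<bar>) ^ q * norm (nth_deriv n (\<lambda>x. f x + g x) x) * ?W
      \<le> (1 + \<bar>x\<bar>) ^ q * (norm (nth_deriv n f x) + norm (nth_deriv n g x)) * ?W"
    unfolding nth_deriv_add[OF fg]
    by (intro mult_right_mono mult_left_mono norm_triangle_ineq) (auto intro: less_imp_le[OF weight_pos])
  hence "ennreal ((1 + \<bar>x\<bar>) ^ q * norm (nth_deriv n (\<lambda>x. f x + g x) x) * ?W)
      \<le> ennreal ((1 + \<bar>x\<bar>) ^ q * norm (nth_deriv n f x) * ?W +
                 (1 + \<bar>x\<bar>) ^ q * norm (nth_deriv n g x) * ?W)"
    by (intro ennreal_leI) (simp add: algebra_simps)
  also have "\<dots> = ennreal ((1 + \<bar>x\<bar>) ^ q * norm (nth_deriv n f x) * ?W) +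
                 ennreal ((1 + \<bar>x\<bar>) ^ q * norm (nth_deriv n g x) * ?W)"
    by (intro ennreal_plus) (auto intro!: mult_nonneg_nonneg less_imp_le[OF weight_pos])
  also have "\<dots> \<le> seminorm_S w lam f + seminorm_S w lam g"
    by (intro add_mono le_seminorm_S[OF w])
  finally show "ennreal ((1 + \<bar>x\<bar>) ^ q * norm (nth_deriv n (\<lambda>x. f x + g x) x) * ?W)
      \<le> seminorm_S w lam f + seminorm_S w lam g" .
qed

section \<open>Continuity of composition with a power\<close>

text \<open>Write \<open>(2 * k + q)!\<close> as \<open>k! * (k + q)!\<close> times a binomial
  coefficient of size at most \<open>4 ^ (n + q)\<close>. As \<open>n! / k! >= 1\<close> and
  \<open>c >= 1\<close>, this ratio may be raised to the power \<open>c\<close>; then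
  \<open>k!\<close> cancels and two factors \<open>(n + q)!\<close> remain.\<close>

lemma fact_ratio_estimate:
  fixes c :: real
  assumes c: "c \<ge> 1" and k: "k \<le> n"
  shows "fact n / fact k * fact (2 * k + q) powr c \<le> (4 powr c) ^ (n + q) * fact (n + q) powr (2 * c)"
proof -
  have "(fact (2 * k + q) :: real) = fact k * fact (k + q) * of_nat ((2 * k + q) choose k)"
    using binomial_fact_lemma[of k "2 * k + q", THEN arg_cong[of _ _ real]] by simp
  also have "\<dots> \<le> fact k * fact (n + q) * 4 ^ (n + q)"
  proof (intro mult_mono)
    have "real ((2 * k + q) choose k) \<le> 2 ^ (2 * k + q)"
      using binomial_le_pow2[of "2 * k + q" k] by (metis of_nat_le_iff of_nat_numeral of_nat_power)
    also have "\<dots> \<le> 2 ^ (2 * (n + q))" using k by (intro power_increasing) auto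
    also have "\<dots> = (2\<^sup>2) ^ (n + q)" by (rule power_mult)
    finally show "real ((2 * k + q) choose k) \<le> 4 ^ (n + q)" by simp
  qed (use k in \<open>auto intro: fact_mono\<close>)
  finally have 1: "fact (2 * k + q) \<le> fact k * fact (n + q) * (4 ^ (n + q) :: real)" .
  have ge1: "(fact n :: real) / fact k \<ge> 1" using k by (simp add: fact_mono)
  have "fact n / fact k = ((fact n :: real) / fact k) powr 1" by simp
  also have "\<dots> \<le> (fact n / fact k) powr c" by (intro powr_mono c ge1)
  also have "\<dots> \<le> (fact (n + q) / fact k) powr c"
    using c by (intro powr_mono2 divide_right_mono fact_mono) auto
  finally have "fact n / fact k * fact (2 * k + q) powr c
      \<le> (fact (n + q) / fact k) powr c * (fact k * fact (n + q) * 4 ^ (n + q)) powr c"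
    using c 1 by (intro mult_mono powr_mono2) auto
  also have "\<dots> = (4 ^ (n + q) * (fact (n + q) * fact (n + q))) powr c"
    by (simp add: mult_ac flip: powr_mult)
  also have "\<dots> = (4 powr c) ^ (n + q) * fact (n + q) powr (2 * c)"
  proof -
    have "(4 ^ (n + q) :: real) powr c = (4 powr c) ^ (n + q)"
      by (simp add: powr_powr mult.commute flip: powr_realpow)
    moreover have "(fact (n + q) * fact (n + q) :: real) powr c = fact (n + q) powr (2 * c)"
      by (simp add: powr_mult flip: powr_add)
    ultimately show ?thesis by (simp add: powr_mult)
  qed
  finally show ?thesis .
qed

text \<open>Since \<open>(2k + q) M \<ge> n + q\<close>, a large \<open>lam\<close> makes \<open>weight c lam (2k + q)\<close> dominate any
  geometric factor in \<open>n + q\<close>.\<close>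

lemma weight_comparison:
  fixes c :: real and M :: nat
  assumes c: "c \<ge> 1" and M: "M \<ge> 1" and lam': "lam' > 0"
  obtains lam where "lam > 0"
    and "\<And>k n q. k \<le> n \<Longrightarrow> n \<le> M * k \<Longrightarrow>
      real (Suc n) * ((2 * real M) ^ n * (fact n / fact k)) * (2 ^ M) ^ (k + q) * weight (2 * c) lam' (n + q)
        \<le> exp lam' * weight c lam (2 * k + q)"
proof -
  \<comment> \<open>The geometric factors: \<open>2\<close> dominates the count
    \<open>n + 1\<close>, \<open>2 * M\<close> comes from the coefficients, \<open>2 ^ M\<close>
    from the growth in \<open>x\<close>, \<open>exp lam'\<close> from \<open>weight_le\<close>,
    \<open>4 powr c\<close> from \<open>fact_ratio_estimate\<close>.\<close>
  define A :: real where "A = 2 * (2 * real M) * 2 ^ M * exp lam' * 4 powr c"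
  have "1 \<le> 1 * 1 * 1 * 1 * (1::real)" by simp
  also have "\<dots> \<le> A" unfolding A_def
    by (intro mult_mono) (use c M lam' in \<open>auto intro: ge_one_powr_ge_zero\<close>)
  finally have A: "A \<ge> 1" .
  \<comment> \<open>Chosen so that the base in \<open>weight_ge\<close> is \<open>A ^ M\<close>; the
    power \<open>M\<close> makes up for \<open>2 * k + q\<close> being possibly smaller than
    \<open>n + q\<close>.\<close>
  define lam where "lam = c * (A ^ M) powr (1 / c)"
  have lam: "lam > 0" "(lam / c) powr c = A ^ M" using A c by (auto simp: lam_def powr_powr)
  show thesis
  proof (rule that[OF lam(1)])
    fix k n q :: nat
    assume k: "k \<le> n" and Mk: "n \<le> M * k"
    define N where "N = n + q"
    define F :: real where "F = fact N powr (2 * c)"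
    define G :: real where "G = fact (2 * k + q) powr c"
    have F: "F > 0" and G: "G > 0" by (auto simp: F_def G_def)
    have "real (Suc n) * ((2 * real M) ^ n * (fact n / fact k)) * (2 ^ M) ^ (k + q) * weight (2 * c) lam' N
      \<le> 2 ^ N * ((2 * real M) ^ N * ((4 powr c) ^ N * F / G)) * (2 ^ M) ^ N * (exp lam' * exp lam' ^ N / F)"
    proof (intro mult_mono)
      have "real (Suc n) \<le> 2 ^ n"
        by (metis Suc_leI less_exp of_nat_le_iff of_nat_numeral of_nat_power)
      also have "\<dots> \<le> 2 ^ N" by (intro power_increasing) (auto simp: N_def)
      finally show "real (Suc n) \<le> 2 ^ N" .
      show "(2 * real M) ^ n \<le> (2 * real M) ^ N"
        using M by (intro power_increasing) (auto simp: N_def)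
      show "fact n / fact k \<le> (4 powr c) ^ N * F / G"
        using fact_ratio_estimate[OF c k, of q] G by (simp add: field_simps F_def G_def N_def)
      show "((2::real) ^ M) ^ (k + q) \<le> (2 ^ M) ^ N"
        using k by (intro power_increasing) (auto simp: N_def)
      show "weight (2 * c) lam' N \<le> exp lam' * exp lam' ^ N / F"
        unfolding F_def using c lam' by (intro weight_le) auto
    qed (use F G in \<open>auto intro: less_imp_le[OF weight_pos]\<close>)
    also have "\<dots> = exp lam' * (A ^ N / G)"
    proof -
      have "(2::real) ^ N * 2 ^ N = 4 ^ N" by (simp flip: power_mult_distrib)
      thus ?thesis using F G by (simp add: A_def power_mult_distrib field_simps)
    qed
    also have "\<dots> \<le> exp lam' * ((A ^ M) ^ (2 * k + q) / G)"
    proof -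
      have "N \<le> M * k + M * q" using Mk M by (simp add: N_def add_mono)
      also have "\<dots> \<le> M * (2 * k + q)" by (simp add: algebra_simps)
      finally have "A ^ N \<le> A ^ (M * (2 * k + q))" using A by (intro power_increasing)
      thus ?thesis using G by (intro mult_left_mono divide_right_mono) (auto simp: power_mult)
    qed
    also have "\<dots> \<le> exp lam' * weight c lam (2 * k + q)"
      using weight_ge[of c lam "2 * k + q"] lam c
      by (intro mult_left_mono) (auto simp: G_def)
    finally show "real (Suc n) * ((2 * real M) ^ n * (fact n / fact k)) * (2 ^ M) ^ (k + q)
        * weight (2 * c) lam' (n + q) \<le> exp lam' * weight c lam (2 * k + q)"
      by (simp add: N_def)
  qed
qed

section \<open>Seminorm estimate for composition with a power\<close>

lemma one_plus_abs_power_le: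
  fixes x :: real
  shows "(1 + \<bar>x\<bar>) ^ M \<le> 2 ^ M * (1 + \<bar>x ^ M\<bar>)"
proof -
  have "(1 + \<bar>x\<bar>) ^ M \<le> (2 * max 1 \<bar>x\<bar>) ^ M" by (intro power_mono) auto
  also have "\<dots> = 2 ^ M * max 1 \<bar>x\<bar> ^ M" by (simp add: power_mult_distrib)
  also have "\<dots> \<le> 2 ^ M * (1 + \<bar>x ^ M\<bar>)"
    by (intro mult_left_mono) (auto simp: max_def power_abs)
  finally show ?thesis .
qed

text \<open>Use \<open>q + (M * k - n) <= M * (k + q)\<close> and then
  \<open>one_plus_abs_power_le\<close>. The price is \<open>k\<close> further powers of growth, so
  order \<open>k\<close> and power \<open>k + q\<close> add up to the weight index
  \<open>2 * k + q\<close>.\<close>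

lemma pow_deriv_term_le:
  fixes f :: "real \<Rightarrow> complex"
  assumes M: "M \<ge> 1" and Mk: "n \<le> M * k"
  shows "(1 + \<bar>x\<bar>) ^ q * norm (of_real (real (pow_coeff M n k) * x ^ (M * k - n)) * nth_deriv k f (x ^ M))
    \<le> (2 * real M) ^ n * (fact n / fact k) * (2 ^ M) ^ (k + q) *
       ((1 + \<bar>x ^ M\<bar>) ^ (k + q) * norm (nth_deriv k f (x ^ M)))"
proof -
  have "real (pow_coeff M n k * fact k) \<le> real ((2 * M) ^ n * fact n)"
    using pow_coeff_le[of M n k] by (simp only: of_nat_le_iff)
  hence co: "real (pow_coeff M n k) \<le> (2 * real M) ^ n * (fact n / fact k)"
    by (simp add: field_simps)
  have "(1 + \<bar>x\<bar>) ^ q * \<bar>x\<bar> ^ (M * k - n) \<le> (1 + \<bar>x\<bar>) ^ q * (1 + \<bar>x\<bar>) ^ (M * k - n)"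
    by (intro mult_left_mono power_mono) auto
  also have "\<dots> = (1 + \<bar>x\<bar>) ^ (q + (M * k - n))" by (simp add: power_add)
  also have "\<dots> \<le> (1 + \<bar>x\<bar>) ^ (M * (k + q))"
  proof (intro power_increasing)
    have "q \<le> M * q" using M by simp
    moreover have "M * (k + q) = M * k + M * q" by (rule add_mult_distrib2)
    ultimately show "q + (M * k - n) \<le> M * (k + q)" by linarith
  qed auto
  also have "\<dots> = ((1 + \<bar>x\<bar>) ^ M) ^ (k + q)" by (simp add: power_mult)
  also have "\<dots> \<le> (2 ^ M * (1 + \<bar>x ^ M\<bar>)) ^ (k + q)"
    by (intro power_mono one_plus_abs_power_le) auto
  finally have "(1 + \<bar>x\<bar>) ^ q * \<bar>x\<bar> ^ (M * k - n) \<le> (2 ^ M) ^ (k + q) * (1 + \<bar>x ^ M\<bar>) ^ (k + q)"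
    by (simp add: power_mult_distrib)
  hence "real (pow_coeff M n k) * ((1 + \<bar>x\<bar>) ^ q * \<bar>x\<bar> ^ (M * k - n)) * norm (nth_deriv k f (x ^ M))
    \<le> (2 * real M) ^ n * (fact n / fact k) * ((2 ^ M) ^ (k + q) * (1 + \<bar>x ^ M\<bar>) ^ (k + q))
        * norm (nth_deriv k f (x ^ M))"
    by (rule mult_right_mono[OF mult_mono[OF co]]) auto
  thus ?thesis by (simp add: norm_mult norm_power power_abs abs_mult mult_ac)
qed

text \<open>As \<open>lam\<close> does not depend on \<open>f\<close>, this yields both that the
  image lies in the codomain and that the map is continuous.\<close>

lemma seminorm_S_comp_power:
  assumes c: "c \<ge> 1" and M: "M \<ge> 1" and lam': "lam' > 0"
    and w: "phi w = (\<lambda>t. exp (t / c))" and v: "phi v = (\<lambda>t. exp (t / (2 * c)))"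
  obtains lam where "lam > 0"
    and "\<And>f. smooth f \<Longrightarrow> seminorm_S v lam' (\<lambda>x. f (x ^ M)) \<le> ennreal (exp lam') * seminorm_S w lam f"
proof -
  obtain lam where lam: "lam > 0" and cmp: "\<And>k n q. k \<le> n \<Longrightarrow> n \<le> M * k \<Longrightarrow>
      real (Suc n) * ((2 * real M) ^ n * (fact n / fact k)) * (2 ^ M) ^ (k + q) * weight (2 * c) lam' (n + q)
        \<le> exp lam' * weight c lam (2 * k + q)"
    using weight_comparison[OF c M lam'] by metis
  show thesis
  proof (rule that[OF lam])
    fix f assume f: "smooth f"
    show "seminorm_S v lam' (\<lambda>x. f (x ^ M)) \<le> ennreal (exp lam') * seminorm_S w lam f"
    proof (cases "seminorm_S w lam f")
      case top
      thus ?thesis by (simp add: ennreal_mult_top)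
    next
      case (real P)
      have P: "(1 + \<bar>y\<bar>) ^ p * norm (nth_deriv k f y) * weight c lam (k + p) \<le> P" for y k p
        using le_seminorm_S[OF w, of y p k f lam] real by simp
      show ?thesis
      proof (subst seminorm_S_le_iff[OF v], intro allI)
        fix x n q
        let ?W = "weight (2 * c) lam' (n + q)"
        let ?t = "\<lambda>k. of_real (real (pow_coeff M n k) * x ^ (M * k - n)) * nth_deriv k f (x ^ M)"
        \<comment> \<open>Each of the \<open>n + 1\<close> summands gets an equal share of the
          bound; the factor \<open>Suc n\<close> in \<open>cmp\<close> provides for it.\<close>
        have "(1 + \<bar>x\<bar>) ^ q * norm (?t k) * ?W \<le> exp lam' * P / real (Suc n)" if k: "k \<le> n" for k
        proof (cases "n \<le> M * k")
          case True
          define Z where "Z = (1 + \<bar>x ^ M\<bar>) ^ (k + q) * norm (nth_deriv k f (x ^ M))"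
          have Z: "Z \<ge> 0" by (simp add: Z_def)
          have "real (Suc n) * ((1 + \<bar>x\<bar>) ^ q * norm (?t k) * ?W) \<le>
            real (Suc n) * ((2 * real M) ^ n * (fact n / fact k) * (2 ^ M) ^ (k + q) * Z * ?W)"
            unfolding Z_def
            by (intro mult_left_mono mult_right_mono pow_deriv_term_le M True less_imp_le[OF weight_pos]) auto
          also have "\<dots> = real (Suc n) * ((2 * real M) ^ n * (fact n / fact k)) * (2 ^ M) ^ (k + q) * ?W * Z"
            by (simp only: mult_ac)
          also have "\<dots> \<le> exp lam' * weight c lam (2 * k + q) * Z"
            by (intro mult_right_mono cmp k True Z)
          also have "\<dots> \<le> exp lam' * P"
          proof -
            have "2 * k + q = k + (k + q)" by simp
            thus ?thesis using P[of "x ^ M" "k + q" k] by (simp only: Z_def mult.commute mult.left_commute) simp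
          qed
          finally show ?thesis by (simp add: field_simps)
        next
          case False
          thus ?thesis using real by (simp add: pow_coeff_eq_0')
        qed
        hence "(\<Sum>k\<le>n. (1 + \<bar>x\<bar>) ^ q * norm (?t k) * ?W) \<le> (\<Sum>k\<le>n. exp lam' * P / real (Suc n))"
          by (intro sum_mono) auto
        also have "\<dots> = exp lam' * P" by simp
        finally have "(1 + \<bar>x\<bar>) ^ q * (\<Sum>k\<le>n. norm (?t k)) * ?W \<le> exp lam' * P"
          by (simp add: sum_distrib_left sum_distrib_right)
        moreover have "(1 + \<bar>x\<bar>) ^ q * norm (pow_deriv M f n x) * ?W
            \<le> (1 + \<bar>x\<bar>) ^ q * (\<Sum>k\<le>n. norm (?t k)) * ?W"
          unfolding pow_deriv_def
          by (intro mult_left_mono mult_right_mono norm_sum less_imp_le[OF weight_pos]) auto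
        ultimately have "(1 + \<bar>x\<bar>) ^ q * norm (nth_deriv n (\<lambda>x. f (x ^ M)) x) * ?W \<le> exp lam' * P"
          unfolding nth_deriv_comp_power[OF f M] by (rule order_trans[rotated])
        thus "ennreal ((1 + \<bar>x\<bar>) ^ q * norm (nth_deriv n (\<lambda>x. f (x ^ M)) x) * ?W)
            \<le> ennreal (exp lam') * seminorm_S w lam f"
          using real by (simp add: ennreal_leI flip: ennreal_mult)
      qed
    qed
  qed
qed

section \<open>From the seminorm estimate to continuity for the generated topologies\<close>

lemma topspace_topology_S: "topspace (topology_S w) = space_S w"
proof -
  have "f \<in> \<Union> {{g \<in> space_S w. p (\<lambda>x. g x - f x) < ennreal \<epsilon>} | p f \<epsilon>.
      p \<in> seminorms_S w \<and> f \<in> space_S w \<and> \<epsilon> > 0}" if "f \<in> space_S w" for f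
  proof (rule UnionI)
    show "{g \<in> space_S w. seminorm_S w 1 (\<lambda>x. g x - f x) < ennreal 1} \<in>
      {{g \<in> space_S w. p (\<lambda>x. g x - f x) < ennreal \<epsilon>} | p f \<epsilon>.
      p \<in> seminorms_S w \<and> f \<in> space_S w \<and> \<epsilon> > 0}"
      using that unfolding seminorms_S_def mem_Collect_eq by (metis zero_less_one)
  qed (use that in \<open>simp add: seminorm_S_zero\<close>)
  thus ?thesis
    unfolding topology_S_def seminorm_topology_def topology_generated_by_topspace by blast
qed

lemma openin_ball_S:
  assumes "lam > 0" "f \<in> space_S w" "\<epsilon> > 0"
  shows "openin (topology_S w) {g \<in> space_S w. seminorm_S w lam (\<lambda>x. g x - f x) < ennreal \<epsilon>}"
  unfolding topology_S_def seminorm_topology_def seminorms_S_def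
  by (intro topology_generated_by_Basis) (use assms in blast)

lemma continuous_operator_S_comp_power:
  assumes c: "c \<ge> 1" and M: "M \<ge> 1"
    and w: "phi w = (\<lambda>t. exp (t / c))" and v: "phi v = (\<lambda>t. exp (t / (2 * c)))"
  shows "continuous_operator_S w v (comp_op (\<lambda>x. x ^ M))"
proof -
  let ?T = "comp_op (\<lambda>x. x ^ M)"
  have T: "?T f = (\<lambda>x. f (x ^ M))" for f by (simp add: comp_op_def o_def)
  have sm: "smooth f" if "f \<in> space_S u" for f u using that by (simp add: space_S_def)
  have into: "?T f \<in> space_S v" if f: "f \<in> space_S w" for f
  proof -
    have "seminorm_S v lam' (?T f) < \<infinity>" if lam': "lam' > 0" for lam'
    proof -
      obtain lam where "lam > 0" "seminorm_S v lam' (?T f) \<le> ennreal (exp lam') * seminorm_S w lam f"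
        using seminorm_S_comp_power[OF c M lam' w v] sm[OF f] unfolding T by metis
      moreover have "ennreal (exp lam') * seminorm_S w lam f < \<infinity>"
        using f \<open>lam > 0\<close> by (simp add: space_S_def ennreal_mult_less_top)
      ultimately show ?thesis by order
    qed
    thus ?thesis using smooth_comp_power[OF sm[OF f] M] by (simp add: space_S_def T)
  qed
  \<comment> \<open>Subbasic sets suffice, but their centre \<open>f\<close> need not be an image,
    so openness of the preimage is checked around each of its points \<open>h\<close>.\<close>
  have opn: "openin (topology_S w) (?T -` {g \<in> space_S v. seminorm_S v lam' (\<lambda>x. g x - f x) < ennreal \<epsilon>}
      \<inter> topspace (topology_S w))" (is "openin _ ?U")
    if lam': "lam' > 0" and f: "f \<in> space_S v" and eps: "\<epsilon> > 0" for lam' f \<epsilon>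
  proof (subst openin_subopen, intro ballI)
    fix h assume "h \<in> ?U"
    hence h: "h \<in> space_S w" and less: "seminorm_S v lam' (\<lambda>x. ?T h x - f x) < ennreal \<epsilon>"
      by (auto simp: topspace_topology_S)
    obtain lam where lam: "lam > 0" and bd:
      "\<And>f. smooth f \<Longrightarrow> seminorm_S v lam' (\<lambda>x. f (x ^ M)) \<le> ennreal (exp lam') * seminorm_S w lam f"
      using seminorm_S_comp_power[OF c M lam' w v] by metis
    obtain r where r: "seminorm_S v lam' (\<lambda>x. ?T h x - f x) = ennreal r" "r \<ge> 0" "r < \<epsilon>"
      using less by (cases "seminorm_S v lam' (\<lambda>x. ?T h x - f x)") (auto simp: ennreal_less_iff)
    \<comment> \<open>The slack left at \<open>h\<close>, divided by the constant of the seminorm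
      estimate.\<close>
    define \<delta> where "\<delta> = (\<epsilon> - r) / exp lam'"
    have \<delta>: "\<delta> > 0" using r by (simp add: \<delta>_def)
    let ?B = "{g \<in> space_S w. seminorm_S w lam (\<lambda>x. g x - h x) < ennreal \<delta>}"
    have "g \<in> ?U" if g: "g \<in> ?B" for g
    proof -
      have gh: "smooth (\<lambda>x. g x - h x)" using g h sm by (intro smooth_diff) auto
      obtain d where d: "seminorm_S w lam (\<lambda>x. g x - h x) = ennreal d" "d \<ge> 0" "d < \<delta>"
        using g by (cases "seminorm_S w lam (\<lambda>x. g x - h x)") (auto simp: ennreal_less_iff)
      have "seminorm_S v lam' (\<lambda>x. ?T g x - f x) =
          seminorm_S v lam' (\<lambda>x. (g (x ^ M) - h (x ^ M)) + (?T h x - f x))"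
        by (simp add: T)
      also have "\<dots> \<le> seminorm_S v lam' (\<lambda>x. g (x ^ M) - h (x ^ M)) + seminorm_S v lam' (\<lambda>x. ?T h x - f x)"
        using smooth_comp_power[OF gh M] smooth_diff[OF sm[OF into[OF h]] sm[OF f]]
        by (intro seminorm_S_add[OF v])
      also have "\<dots> \<le> ennreal (exp lam') * ennreal d + ennreal r"
        using bd[OF gh] r d by (intro add_mono) auto
      also have "\<dots> = ennreal (exp lam' * d + r)"
        using r d by (simp add: ennreal_mult)
      also have "\<dots> < ennreal \<epsilon>"
        using d r eps by (intro ennreal_lessI) (auto simp: \<delta>_def field_simps)
      finally show ?thesis using g into by (auto simp: topspace_topology_S)
    qed
    moreover have "h \<in> ?B" using h \<delta> by (simp add: seminorm_S_zero)
    ultimately show "\<exists>B. openin (topology_S w) B \<and> h \<in> B \<and> B \<subseteq> ?U"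
      using openin_ball_S[OF lam h \<delta>] by blast
  qed
  have "continuous_map (topology_S w) (topology_S v) ?T"
    unfolding topology_S_def[of v] seminorm_topology_def
  proof (rule continuous_on_generated_topo)
    show "?T ` topspace (topology_S w) \<subseteq> \<Union> {{g \<in> space_S v. p (\<lambda>x. g x - f x) < ennreal \<epsilon>} | p f \<epsilon>.
        p \<in> seminorms_S v \<and> f \<in> space_S v \<and> \<epsilon> > 0}"
      using into topspace_topology_S[of v]
      unfolding topology_S_def[of v] seminorm_topology_def topology_generated_by_topspace
      by (auto simp: topspace_topology_S)
  qed (auto simp: seminorms_S_def intro: opn)
  moreover have "linear_map_on (space_S w) ?T"
    by (simp add: linear_map_on_def T)
  ultimately show ?thesis by (simp add: continuous_operator_S_def)
qed

section \<open>Translated Gaussians\<close>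

text \<open>The probabilists' Hermite polynomials; at \<open>n = 0\<close> the truncated index
  \<open>n - 1\<close> carries the factor zero. Taken at \<open>b - x\<close>, they give the
  derivatives of the Gaussian without alternating signs.\<close>

fun hermite :: "nat \<Rightarrow> real \<Rightarrow> real" where
  "hermite 0 y = 1"
| "hermite (Suc n) y = y * hermite n y - real n * hermite (n - 1) y"

lemma hermite_has_derivative:
  "(hermite n has_real_derivative real n * hermite (n - 1) y) (at y)"
proof (induction n rule: less_induct)
  case (less n)
  show ?case
  proof (cases n)
    case (Suc m)
    have "(hermite m has_real_derivative real m * hermite (m - 1) y) (at y)"
      "(hermite (m - 1) has_real_derivative real (m - 1) * hermite (m - 1 - 1) y) (at y)"
      by (rule less.IH; simp add: Suc)+
    hence "((\<lambda>y. y * hermite m y - real m * hermite (m - 1) y) has_real_derivative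
        hermite m y + y * (real m * hermite (m - 1) y)
          - real m * (real (m - 1) * hermite (m - 1 - 1) y)) (at y)"
      by (auto intro!: derivative_eq_intros)
    moreover have "hermite m y + y * (real m * hermite (m - 1) y)
          - real m * (real (m - 1) * hermite (m - 1 - 1) y) = real n * hermite (n - 1) y"
      by (cases m) (auto simp: Suc algebra_simps)
    ultimately show ?thesis by (simp add: Suc)
  qed auto
qed

text \<open>The two claims feed each other: monotonicity turns the recurrence into
  \<open>hermite (Suc n) y >= (y - n) * hermite n y\<close>, where
  \<open>y - n >= 1\<close>.\<close>

lemma hermite_increasing:
  assumes "n \<le> m" "real m \<le> y"
  shows "hermite n y \<ge> 1 \<and> hermite (n - 1) y \<le> hermite n y"
  using assms
proof (induction n)
  case (Suc n)
  have IH: "hermite n y \<ge> 1" "hermite (n - 1) y \<le> hermite n y" using Suc by auto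
  have "hermite n y = 1 * hermite n y" by simp
  also have "\<dots> \<le> (y - real n) * hermite n y"
    using Suc.prems IH by (intro mult_right_mono) auto
  also have "\<dots> = y * hermite n y - real n * hermite n y" by (simp add: algebra_simps)
  also have "\<dots> \<le> y * hermite n y - real n * hermite (n - 1) y"
    using IH by (intro diff_left_mono mult_left_mono) auto
  finally show ?case using IH by simp
qed auto

text \<open>The factor \<open>y\<close> in the recurrence raises \<open>j\<close> by one, so the
  induction runs over all \<open>j\<close> at once. Both terms of the recurrence obey the same
  bound, whence \<open>2 ^ n\<close>.\<close>

lemma abs_power_hermite_le:
  "\<bar>y\<bar> ^ j * (\<bar>hermite n y\<bar> * exp (- y\<^sup>2 / 2)) \<le> 2 * 2 ^ n * fact (j + n)"
proof (induction n arbitrary: j rule: less_induct)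
  case (less n)
  show ?case
  proof (cases n)
    case 0
    have "\<bar>y\<bar> ^ j \<le> fact j * exp \<bar>y\<bar>"
      using power_div_fact_le_exp[of "\<bar>y\<bar>" j] by (simp add: field_simps)
    hence "\<bar>y\<bar> ^ j * exp (- y\<^sup>2 / 2) \<le> fact j * exp \<bar>y\<bar> * exp (- y\<^sup>2 / 2)"
      by (intro mult_right_mono) auto
    also have "\<dots> = fact j * exp (\<bar>y\<bar> - y\<^sup>2 / 2)" by (simp flip: exp_add)
    also have "\<dots> \<le> fact j * 2"
    proof (intro mult_left_mono)
      \<comment> \<open>Completing the square.\<close>
      have "\<bar>y\<bar> - y\<^sup>2 / 2 \<le> 1 / 2"
        using zero_le_power2[of "\<bar>y\<bar> - 1"] by (simp add: power2_eq_square algebra_simps)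
      moreover have "exp (1 / 2 :: real) \<le> 2"
        using exp_bound_half[of "1 / 2 :: real"] by simp
      ultimately show "exp (\<bar>y\<bar> - y\<^sup>2 / 2) \<le> 2" using exp_le_cancel_iff order_trans by blast
    qed auto
    finally show ?thesis using 0 by simp
  next
    case (Suc m)
    let ?E = "exp (- y\<^sup>2 / 2)"
    have 1: "\<bar>y\<bar> ^ Suc j * (\<bar>hermite m y\<bar> * ?E) \<le> 2 * 2 ^ m * fact (Suc j + m)"
      by (rule less.IH) (simp add: Suc)
    have "real m * (\<bar>y\<bar> ^ j * (\<bar>hermite (m - 1) y\<bar> * ?E)) \<le> real m * (2 * 2 ^ (m - 1) * fact (j + (m - 1)))"
      by (intro mult_left_mono less.IH) (auto simp: Suc)
    also have "\<dots> \<le> real (Suc (j + m)) * (2 * 2 ^ m * fact (j + m))"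
      by (intro mult_mono fact_mono power_increasing) auto
    also have "\<dots> = 2 * 2 ^ m * fact (Suc j + m)" by simp
    finally have 2: "real m * (\<bar>y\<bar> ^ j * (\<bar>hermite (m - 1) y\<bar> * ?E)) \<le> 2 * 2 ^ m * fact (Suc j + m)" .
    have "\<bar>hermite n y\<bar> \<le> \<bar>y\<bar> * \<bar>hermite m y\<bar> + real m * \<bar>hermite (m - 1) y\<bar>"
      using abs_triangle_ineq4[of "y * hermite m y" "real m * hermite (m - 1) y"]
      by (simp add: Suc abs_mult)
    hence "\<bar>y\<bar> ^ j * (\<bar>hermite n y\<bar> * ?E) \<le>
        \<bar>y\<bar> ^ j * ((\<bar>y\<bar> * \<bar>hermite m y\<bar> + real m * \<bar>hermite (m - 1) y\<bar>) * ?E)"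
      by (intro mult_left_mono mult_right_mono) auto
    also have "\<dots> = \<bar>y\<bar> ^ Suc j * (\<bar>hermite m y\<bar> * ?E) + real m * (\<bar>y\<bar> ^ j * (\<bar>hermite (m - 1) y\<bar> * ?E))"
      by (simp add: algebra_simps)
    also have "\<dots> \<le> 2 * 2 ^ n * fact (j + n)" using 1 2 by (simp add: Suc)
    finally show ?thesis .
  qed
qed

definition gauss :: "real \<Rightarrow> real \<Rightarrow> complex" where
  "gauss b x = of_real (exp (- (b - x)\<^sup>2 / 2))"

definition gauss_deriv :: "real \<Rightarrow> nat \<Rightarrow> real \<Rightarrow> complex" where
  "gauss_deriv b n x = of_real (hermite n (b - x) * exp (- (b - x)\<^sup>2 / 2))"

lemma gauss_deriv_has_vector_derivative:
  "(gauss_deriv b n has_vector_derivative gauss_deriv b (Suc n) x) (at x)"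
proof -
  have "((\<lambda>x. hermite n (b - x)) has_real_derivative real n * hermite (n - 1) (b - x) * (-1)) (at x)"
    by (rule DERIV_chain2[OF hermite_has_derivative]) (auto intro!: derivative_eq_intros)
  hence "((\<lambda>x. hermite n (b - x) * exp (- (b - x)\<^sup>2 / 2)) has_real_derivative
      hermite (Suc n) (b - x) * exp (- (b - x)\<^sup>2 / 2)) (at x)"
    by (auto intro!: derivative_eq_intros simp: field_simps power2_eq_square)
  thus ?thesis
    unfolding gauss_deriv_def[abs_def]
    by (intro has_vector_derivative_of_real) (simp add: has_real_derivative_iff_has_vector_derivative)
qed

lemma
  shows smooth_gauss: "smooth (gauss b)"
    and nth_deriv_gauss: "nth_deriv n (gauss b) = gauss_deriv b n"
  by (rule smoothI[where G = "gauss_deriv b"] nth_deriv_eqI[where G = "gauss_deriv b"],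
      simp add: gauss_def gauss_deriv_def, rule gauss_deriv_has_vector_derivative)+

lemma gauss_deriv_le:
  assumes "b \<ge> 0"
  shows "(1 + \<bar>x\<bar>) ^ q * norm (gauss_deriv b n x) \<le> 4 * (4 * (1 + b)) ^ (n + q) * fact (n + q)"
proof -
  define y where "y = b - x"
  define N where "N = n + q"
  define H where "H = \<bar>hermite n y\<bar> * exp (- y\<^sup>2 / 2)"
  have H: "H \<ge> 0" by (simp add: H_def)
  have "1 + \<bar>x\<bar> \<le> (1 + b) + \<bar>y\<bar>"
    using assms by (simp add: y_def)
  \<comment> \<open>The maximum turns the power of a sum into a sum of powers, which
    \<open>abs_power_hermite_le\<close> covers with exponents \<open>0\<close> and
    \<open>q\<close>.\<close>
  also have "\<dots> \<le> 2 * max (1 + b) \<bar>y\<bar>"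
    using add_mono[OF max.cobounded1[of "1 + b" "\<bar>y\<bar>"] max.cobounded2[of "\<bar>y\<bar>" "1 + b"]] by simp
  finally have "(1 + \<bar>x\<bar>) ^ q \<le> (2 * max (1 + b) \<bar>y\<bar>) ^ q"
    by (intro power_mono) auto
  also have "\<dots> = 2 ^ q * max (1 + b) \<bar>y\<bar> ^ q" by (simp add: power_mult_distrib)
  also have "\<dots> \<le> 2 ^ q * ((1 + b) ^ q + \<bar>y\<bar> ^ q)"
    using assms by (intro mult_left_mono) (auto simp: max_def)
  finally have "(1 + \<bar>x\<bar>) ^ q * H \<le> 2 ^ q * ((1 + b) ^ q + \<bar>y\<bar> ^ q) * H"
    using H by (intro mult_right_mono)
  also have "\<dots> = 2 ^ q * ((1 + b) ^ q * (\<bar>y\<bar> ^ 0 * H) + \<bar>y\<bar> ^ q * H)" by (simp add: algebra_simps)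
  also have "\<dots> \<le> 2 ^ q * ((1 + b) ^ q * (2 * 2 ^ n * fact (0 + n)) + 2 * 2 ^ n * fact (q + n))"
    unfolding H_def using assms by (intro mult_left_mono add_mono abs_power_hermite_le) auto
  also have "\<dots> \<le> 2 ^ N * ((1 + b) ^ N * (2 * 2 ^ N * fact N) + (1 + b) ^ N * (2 * 2 ^ N * fact N))"
  proof -
    have 1: "(1 + b) ^ q * (2 * 2 ^ n * fact (0 + n)) \<le> (1 + b) ^ N * (2 * 2 ^ N * fact N)"
      using assms by (intro mult_mono) (auto simp: N_def intro!: power_increasing fact_mono)
    have "2 * 2 ^ n * fact (q + n) \<le> 1 * (2 * 2 ^ N * (fact N :: real))"
      by (auto simp: N_def add.commute)
    also have "\<dots> \<le> (1 + b) ^ N * (2 * 2 ^ N * fact N)"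
      using assms by (intro mult_right_mono) auto
    finally have 2: "2 * 2 ^ n * fact (q + n) \<le> (1 + b) ^ N * (2 * 2 ^ N * fact N)" .
    show ?thesis
      by (rule mult_mono[OF _ add_mono[OF 1 2]]) (use assms in \<open>auto simp: N_def\<close>)
  qed
  also have "\<dots> = 4 * (2 * 2 * (1 + b)) ^ N * fact N" by (simp only: power_mult_distrib) simp
  finally show ?thesis
    by (simp add: gauss_deriv_def H_def y_def N_def norm_mult)
qed

text \<open>Up to geometric factors the derivatives grow at most like \<open>N!\<close> and the
  weight decays like \<open>1 / N! powr c\<close>; the surplus \<open>N! powr (c - 1)\<close> beats
  any geometric factor since \<open>c > 1\<close>.\<close>

lemma gauss_in_space_S:
  assumes c: "c > 1" and w: "phi w = (\<lambda>t. exp (t / c))" and b: "b \<ge> 0"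
  shows "gauss b \<in> space_S w"
proof -
  have "seminorm_S w lam (gauss b) < \<infinity>" if lam: "lam > 0" for lam
  proof -
    define A where "A = 4 * (1 + b) * exp lam"
    \<comment> \<open>This root turns \<open>A ^ N / N! powr (c - 1)\<close> into a power of
      \<open>B ^ N / N!\<close>, which is at most \<open>exp B\<close>.\<close>
    define B where "B = A powr (1 / (c - 1))"
    have A: "A > 0" using b by (simp add: A_def)
    have B: "B > 0" "B powr (c - 1) = A" using A c by (auto simp: B_def powr_powr)
    have "seminorm_S w lam (gauss b) \<le> ennreal (4 * exp lam * exp B powr (c - 1))"
    proof (subst seminorm_S_le_iff[OF w], intro allI ennreal_leI)
      fix x :: real and n q :: nat
      define N where "N = n + q"
      have "(1 + \<bar>x\<bar>) ^ q * norm (nth_deriv n (gauss b) x) * weight c lam N \<le>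
         4 * (4 * (1 + b)) ^ N * fact N * (exp lam * exp lam ^ N / fact N powr c)"
        unfolding N_def nth_deriv_gauss using b c lam
        by (intro mult_mono gauss_deriv_le weight_le) (auto intro: less_imp_le[OF weight_pos])
      also have "\<dots> = 4 * exp lam * (A ^ N / fact N powr (c - 1))"
        unfolding A_def power_mult_distrib by (simp add: powr_diff)
      also have "A ^ N / fact N powr (c - 1) = (B ^ N / fact N) powr (c - 1)"
        using B(1) unfolding B(2)[symmetric]
        by (simp add: powr_divide powr_powr mult.commute flip: powr_realpow)
      also have "4 * exp lam * (B ^ N / fact N) powr (c - 1) \<le> 4 * exp lam * exp B powr (c - 1)"
        using B c by (intro mult_left_mono powr_mono2 power_div_fact_le_exp) auto
      finally show "(1 + \<bar>x\<bar>) ^ q * norm (nth_deriv n (gauss b) x) * weight c lam (n + q)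
          \<le> 4 * exp lam * exp B powr (c - 1)" by (simp add: N_def)
    qed
    thus ?thesis by (rule order.strict_trans1) simp
  qed
  thus ?thesis by (simp add: space_S_def smooth_gauss)
qed

section \<open>Failure of the uniform estimate\<close>

text \<open>At \<open>1\<close> all monomials equal one, and the centre \<open>n + 1\<close> puts
  the Hermite polynomials at \<open>n\<close>, where those of degree up to \<open>n\<close> are
  positive. Nothing cancels, so the sum dominates its last term, with coefficient
  \<open>M ^ n\<close>.\<close>

lemma norm_pow_deriv_gauss_ge:
  "real M ^ n * exp (- (real n)\<^sup>2 / 2) \<le> norm (pow_deriv M (gauss (real n + 1)) n 1)"
proof -
  define E where "E = exp (- (real n)\<^sup>2 / 2)"
  have H: "hermite k (real n) \<ge> 1" if "k \<le> n" for k
    using hermite_increasing[OF that, of "real n"] by simp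
  let ?t = "\<lambda>k. real (pow_coeff M n k) * (hermite k (real n) * E)"
  have nonneg: "?t k \<ge> 0" if "k \<le> n" for k
    using H[OF that] by (auto simp: E_def)
  have "real M ^ n * E \<le> ?t n"
    using H[of n] by (auto simp: pow_coeff_self E_def intro!: mult_left_mono)
  also have "\<dots> \<le> (\<Sum>k\<le>n. ?t k)"
    using nonneg by (intro member_le_sum) auto
  also have "\<dots> = norm (of_real (\<Sum>k\<le>n. ?t k) :: complex)"
    unfolding norm_of_real using nonneg by (intro abs_of_nonneg[symmetric] sum_nonneg) auto
  also have "of_real (\<Sum>k\<le>n. ?t k) = pow_deriv M (gauss (real n + 1)) n 1"
    by (simp add: pow_deriv_def nth_deriv_gauss gauss_deriv_def E_def)
  finally show ?thesis by (simp add: E_def)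
qed

lemma square_funpow: "((\<lambda>x::real. x ^ 2) ^^ m) = (\<lambda>x. x ^ (2 ^ m))"
  by (induction m) (auto simp: fun_eq_iff mult.commute simp flip: power_mult)

theorem proposition2p3:
  fixes s :: real and \<omega> \<sigma> \<psi> :: "real \<Rightarrow> real"
  assumes "\<psi> = (\<lambda>x. x ^ 2)"
    and "s > 1"
    and "\<omega> = (\<lambda>t. \<bar>t\<bar> powr (1 / s))"
    and "\<sigma> = (\<lambda>t. \<omega> (t powr (1 / 2)))"
  shows "(\<forall>m\<ge>1. continuous_operator_S \<omega> \<sigma> (comp_op (\<psi> ^^ m)))
    \<and> \<not> m_topologizable (space_S \<omega>) (seminorms_S \<omega>) (seminorms_S \<sigma>) (\<lambda>m. comp_op (\<psi> ^^ m))"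
proof
  have w: "phi \<omega> = (\<lambda>t. exp (t / s))"
    by (simp add: fun_eq_iff phi_def assms(3) powr_def)
  have v: "phi \<sigma> = (\<lambda>t. exp (t / (2 * s)))"
    by (simp add: fun_eq_iff phi_def assms(3,4) powr_def)
  have psi: "\<psi> ^^ m = (\<lambda>x. x ^ (2 ^ m))" for m
    by (simp add: assms(1) square_funpow)
  show "\<forall>m\<ge>1. continuous_operator_S \<omega> \<sigma> (comp_op (\<psi> ^^ m))"
    unfolding psi using assms(2) by (intro allI impI continuous_operator_S_comp_power[OF _ _ w v]) auto
  show "\<not> m_topologizable (space_S \<omega>) (seminorms_S \<omega>) (seminorms_S \<sigma>) (\<lambda>m. comp_op (\<psi> ^^ m))"
  proof
    assume "m_topologizable (space_S \<omega>) (seminorms_S \<omega>) (seminorms_S \<sigma>) (\<lambda>m. comp_op (\<psi> ^^ m))"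
    moreover have "seminorm_S \<sigma> 1 \<in> seminorms_S \<sigma>" by (auto simp: seminorms_S_def)
    ultimately obtain q C where "q \<in> seminorms_S \<omega>" and C: "C \<ge> 1"
      and *: "\<And>m f. m \<ge> 1 \<Longrightarrow> f \<in> space_S \<omega> \<Longrightarrow>
        seminorm_S \<sigma> 1 (comp_op (\<psi> ^^ m) f) \<le> ennreal (C ^ m) * q f"
      unfolding m_topologizable_def by metis
    then obtain lam where q: "q = seminorm_S \<omega> lam" and lam: "lam > 0"
      by (auto simp: seminorms_S_def)
    \<comment> \<open>\<open>n\<close>, and with it the test function, depends on \<open>C\<close>
      alone, so \<open>m\<close> remains free.\<close>
    obtain n where n: "C < 2 ^ n" using real_arch_pow[of 2 C] by auto
    define f where "f = gauss (real n + 1)"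
    have f: "f \<in> space_S \<omega>"
      unfolding f_def by (rule gauss_in_space_S[OF assms(2) w]) simp
    hence fs: "smooth f" and "q f < \<infinity>" using lam by (auto simp: space_S_def q)
    then obtain P where P: "q f = ennreal P" "P \<ge> 0"
      by (cases "q f") auto
    define a where "a = exp (- (real n)\<^sup>2 / 2) * weight (2 * s) 1 n"
    have a: "a > 0" by (simp add: a_def weight_pos)
    have bound: "(2 ^ n / C) ^ m \<le> P / a" if m: "m \<ge> 1" for m
    proof -
      have "ennreal (norm (pow_deriv (2 ^ m) f n 1) * weight (2 * s) 1 n)
          \<le> seminorm_S \<sigma> 1 (\<lambda>x. f (x ^ 2 ^ m))"
        using le_seminorm_S[OF v, of 1 0 n "\<lambda>x. f (x ^ 2 ^ m)" 1] nth_deriv_comp_power[OF fs, of "2 ^ m" n]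
        by simp
      also have "\<dots> \<le> ennreal (C ^ m) * ennreal P"
        using *[OF m f] by (simp add: psi comp_op_def o_def P)
      also have "\<dots> = ennreal (C ^ m * P)" using C P by (simp add: ennreal_mult)
      finally have "norm (pow_deriv (2 ^ m) f n 1) * weight (2 * s) 1 n \<le> C ^ m * P"
        using C P by (subst (asm) ennreal_le_iff) auto
      moreover have "real (2 ^ m) ^ n * exp (- (real n)\<^sup>2 / 2) * weight (2 * s) 1 n
          \<le> norm (pow_deriv (2 ^ m) f n 1) * weight (2 * s) 1 n"
        unfolding f_def by (intro mult_right_mono norm_pow_deriv_gauss_ge less_imp_le[OF weight_pos])
      ultimately have "(2 ^ m) ^ n * a \<le> C ^ m * P" by (simp add: a_def mult.assoc)
      \<comment> \<open>At fixed order \<open>n\<close> the growth in \<open>m\<close> is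
        exponential with base \<open>2 ^ n\<close>.\<close>
      moreover have "((2::real) ^ m) ^ n = (2 ^ n) ^ m" by (simp add: mult.commute flip: power_mult)
      ultimately show ?thesis using a C by (simp add: power_divide field_simps)
    qed
    \<comment> \<open>This \<open>m\<close> may be zero while \<open>bound\<close> needs a positive
      index, hence the passage to \<open>Suc m\<close>.\<close>
    obtain m where "P / a < (2 ^ n / C) ^ m"
      using real_arch_pow[of "2 ^ n / C" "P / a"] n C by auto
    also have "\<dots> \<le> (2 ^ n / C) ^ Suc m"
      using n C by (intro power_increasing) auto
    finally show False using bound[of "Suc m"] by simp
  qed
qed

end
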